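(* Let $\mathbb F_q$ be a finite field with $q$ elements and let $a,b$ be integers with $0\le b\le a\le q-2$. Let $\square\subseteq\mathbb R^2$ be the polytope with vertices $(0,0),(a,0),(b,q-2),(0,q-2)$, and let $U=\mathbb Z^2\cap\square$. Let $\mathcal M(U)$ be the linear secret sharing scheme with support $T(\mathbb F_q)=(\mathbb F_q^* )^2$ and $n=(q-1)^2-1$ players. Then: (1) The maximal number of zeros on $T(\mathbb F_q)$ of a non-zero $f\in\mathbb F_q[U]$ is less than or equal to $(q-1)^2-(q-1-a)$. (2) The reconstruction threshold satisfies $r(U)\le 1+(q-1)^2-(q-1-a)$. (3) The privacy threshold satisfies $t(U)\ge b-1$. (4) Assume $2a\le q-2$. Then the scheme has $t$-strong multiplication for every integer $t\ge 0$ with $$t\le\min\{b-1,\ (q-2-2a)-1\}.$$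
   Context: $\mathbb F_q[U]$ is the $\mathbb F_q$-linear span of the monomials $X_1^{u_1}X_2^{u_2}$, $(u_1,u_2)\in U$, in $\mathbb F_q[X_1^{\pm1},X_2^{\pm1}]$. The scheme $\mathcal M(U)$ with support $T(\mathbb F_q)$: fix a point $P_0\in T(\mathbb F_q)$; the players are the $n=|T(\mathbb F_q)|-1$ points of $T(\mathbb F_q)\setminus\{P_0\}$. For a secret $s_0\in\mathbb F_q$, an $f\in\mathbb F_q[U]$ with $f(P_0)=s_0$ is chosen at random; the share of player $P$ is $f(P)$. A set $A$ of players determines the secret if $f(P_0)$ is determined by $(f(P))_{P\in A}$, i.e. if every $f\in\mathbb F_q[U]$ vanishing on $A$ satisfies $f(P_0)=0$. The reconstruction threshold $r(U)$ is the smallest integer $m\ge0$ such that every set of at least $m$ players determines the secret (for $m=n+1$ the condition is vacuous). The privacy threshold $t(U)$ is the largest integer $t\le n$ such that no set of $t$ or fewer players determines the secret; the scheme has $t$-privacy if no set of $t$ or fewer players determines the secret. The scheme has $t$-strong multiplication if it has $t$-privacy and, for every set $A$ of at most $t$ players and any two secrets $s,\tilde s$ shared by $f,\tilde f\in\mathbb F_q[U]$, the products $f(P)\tilde f(P)$ of the shares of the players $P\notin A$ determine the product $s\tilde s=f(P_0)\tilde f(P_0)$. *)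

theory Defs
  imports "HOL-Analysis.Analysis" "HOL-Library.Poly_Mapping"
begin

text \<open>The ring of Laurent polynomials in two variables over a field is the group ring of the
  additive group of exponent vectors; the multiplication on \<open>\<Rightarrow>\<^sub>0\<close> is convolution.\<close>

type_synonym 'k laurent2 = "(int \<times> int) \<Rightarrow>\<^sub>0 'k"

definition laurent_scale :: "'k::field \<Rightarrow> 'k laurent2 \<Rightarrow> 'k laurent2"
  where "laurent_scale c f = Poly_Mapping.single 0 c * f"

interpretation laurent: vector_space laurent_scale
  by unfold_locales
    (simp_all add: laurent_scale_def algebra_simps single_add mult_single flip: mult.assoc)

definition laurent_monomial :: "int \<times> int \<Rightarrow> 'k::field laurent2"
  where "laurent_monomial u = Poly_Mapping.single u 1"

definition laurent_space :: "(int \<times> int) set \<Rightarrow> 'k::field laurent2 set"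
  where "laurent_space U = laurent.span (laurent_monomial ` U)"

text \<open>Exponents may be negative, so this is meaningful only for points of the torus.\<close>

definition laurent_eval :: "'k::field laurent2 \<Rightarrow> 'k \<times> 'k \<Rightarrow> 'k"
  where "laurent_eval f P =
    (\<Sum>u\<in>Poly_Mapping.keys f. Poly_Mapping.lookup f u * (fst P powi fst u * snd P powi snd u))"

definition torus :: "('k::field \<times> 'k) set"
  where "torus = {(x, y). x \<noteq> 0 \<and> y \<noteq> 0}"

definition torus_zeros :: "'k::field laurent2 \<Rightarrow> ('k \<times> 'k) set"
  where "torus_zeros f = {P \<in> torus. laurent_eval f P = 0}"

definition lattice_points :: "(real \<times> real) set \<Rightarrow> (int \<times> int) set"
  where "lattice_points S = {(u, v). (real_of_int u, real_of_int v) \<in> S}"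

text \<open>The scheme \<open>\<M>(U)\<close> is given by the exponent set \<open>U\<close> and the point \<open>P0\<close> of the torus
  at which the secret sits.\<close>

definition players :: "'k::field \<times> 'k \<Rightarrow> ('k \<times> 'k) set"
  where "players P0 = torus - {P0}"

definition determines_secret ::
    "(int \<times> int) set \<Rightarrow> 'k::field \<times> 'k \<Rightarrow> ('k \<times> 'k) set \<Rightarrow> bool"
  where "determines_secret U P0 A \<longleftrightarrow>
    (\<forall>f\<in>laurent_space U. (\<forall>P\<in>A. laurent_eval f P = 0) \<longrightarrow> laurent_eval f P0 = 0)"

definition reconstruction_threshold ::
    "(int \<times> int) set \<Rightarrow> 'k::{field,finite} \<times> 'k \<Rightarrow> nat"
  where "reconstruction_threshold U P0 =
    (LEAST m. \<forall>A \<subseteq> players P0. card A \<ge> m \<longrightarrow> determines_secret U P0 A)"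

definition has_privacy ::
    "(int \<times> int) set \<Rightarrow> 'k::{field,finite} \<times> 'k \<Rightarrow> int \<Rightarrow> bool"
  where "has_privacy U P0 t \<longleftrightarrow>
    (\<forall>A \<subseteq> players P0. int (card A) \<le> t \<longrightarrow> \<not> determines_secret U P0 A)"

text \<open>The threshold ranges over all integers. Every negative \<open>t\<close> qualifies vacuously, so the
  maximum always exists.\<close>

definition privacy_threshold ::
    "(int \<times> int) set \<Rightarrow> 'k::{field,finite} \<times> 'k \<Rightarrow> int"
  where "privacy_threshold U P0 =
    (GREATEST t. t \<le> int (card (players P0)) \<and> has_privacy U P0 t)"

text \<open>That the products of shares outside \<open>A\<close> determine the product of the secrets means that
  two pairs of sharings with the same products outside \<open>A\<close> have the same product of secrets.\<close>

definition has_strong_multiplication ::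
    "(int \<times> int) set \<Rightarrow> 'k::{field,finite} \<times> 'k \<Rightarrow> int \<Rightarrow> bool"
  where "has_strong_multiplication U P0 t \<longleftrightarrow>
    has_privacy U P0 t \<and>
    (\<forall>A \<subseteq> players P0. int (card A) \<le> t \<longrightarrow>
      (\<forall>f\<in>laurent_space U. \<forall>f'\<in>laurent_space U.
       \<forall>g\<in>laurent_space U. \<forall>g'\<in>laurent_space U.
        (\<forall>P\<in>players P0 - A.
          laurent_eval f P * laurent_eval f' P = laurent_eval g P * laurent_eval g' P) \<longrightarrow>
        laurent_eval f P0 * laurent_eval f' P0 = laurent_eval g P0 * laurent_eval g' P0))"

lemma laurent_space_eq_keys: "laurent_space U = {f. Poly_Mapping.keys f \<subseteq> U}"
proof (intro set_eqI iffI; simp only: mem_Collect_eq)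
  fix f :: "'a laurent2"
  assume "f \<in> laurent_space U"
  then have "f \<in> laurent.span (laurent_monomial ` U)"
    by (simp add: laurent_space_def)
  then show "Poly_Mapping.keys f \<subseteq> U"
  proof (induction rule: laurent.span_induct_alt)
    case (step c x y)
    then obtain u where "u \<in> U" "x = Poly_Mapping.single u 1"
      by (auto simp: laurent_monomial_def)
    then have "Poly_Mapping.keys (laurent_scale c x) \<subseteq> U"
      by (simp add: laurent_scale_def mult_single)
    with step show ?case
      using keys_add[of "laurent_scale c x" y] by blast
  qed simp
next
  fix f :: "'a laurent2"
  assume "Poly_Mapping.keys f \<subseteq> U"
  then have "(\<Sum>u\<in>Poly_Mapping.keys f.
      laurent_scale (Poly_Mapping.lookup f u) (laurent_monomial u)) \<in> laurent_space U"
    unfolding laurent_space_def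
    by (intro laurent.span_sum laurent.span_scale laurent.span_base) auto
  also have "(\<Sum>u\<in>Poly_Mapping.keys f.
      laurent_scale (Poly_Mapping.lookup f u) (laurent_monomial u)) = f"
    by (rule poly_mapping_eqI)
      (simp add: laurent_scale_def laurent_monomial_def mult_single lookup_sum lookup_single
        when_def in_keys_iff)
  finally show "f \<in> laurent_space U" .
qed

lemma card_torus: "card (torus :: ('k::{field,finite} \<times> 'k) set) = (CARD('k) - 1)\<^sup>2"
proof -
  have "(torus :: ('k \<times> 'k) set) = (UNIV - {0}) \<times> (UNIV - {0})"
    by (auto simp: torus_def)
  then have "card (torus :: ('k \<times> 'k) set) = card (UNIV - {0 :: 'k}) * card (UNIV - {0 :: 'k})"
    by (metis card_cartesian_product)
  also have "card (UNIV - {0 :: 'k}) = CARD('k) - 1"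
    by (rule card_Diff_singleton) simp
  finally show ?thesis
    by (simp only: power2_eq_square)
qed

end

theory Submission
  imports Defs "HOL-Computational_Algebra.Polynomial"
begin

text \<open>Restricting \<open>f \<in> \<F>\<^sub>q[U]\<close> to a horizontal line \<open>X\<^sub>2 = y\<close> gives a univariate polynomial of
  degree at most \<open>a\<close> in \<open>X\<^sub>1\<close>. For non-zero \<open>f\<close> some coefficient of this polynomial, a non-zero
  polynomial of degree at most \<open>q - 2\<close> in \<open>y\<close>, does not vanish at some \<open>y \<noteq> 0\<close>, and on that line
  \<open>f\<close> has at least \<open>q - 1 - a\<close> non-zeros. Likewise, if two products of sharings differ at \<open>P\<^sub>0\<close>, then
  on the line through \<open>P\<^sub>0\<close> their difference has degree at most \<open>2a\<close>, hence at least \<open>q - 1 - 2a\<close>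
  non-zeros, more than \<open>A \<union> {P\<^sub>0}\<close> can hold. For privacy, the rectangle \<open>[0,b] \<times> [0,q-2]\<close> lies in the
  polytope, so \<open>\<F>\<^sub>q[U]\<close> contains the product of a polynomial in \<open>X\<^sub>1\<close> vanishing at the abscissae of
  \<open>A\<close> other than that of \<open>P\<^sub>0\<close> and a polynomial in \<open>X\<^sub>2\<close> vanishing on every ordinate but
  that of \<open>P\<^sub>0\<close>.\<close>

section \<open>Evaluation and restriction to horizontal lines\<close>

lemma laurent_eval_superset:
  assumes "finite S" "Poly_Mapping.keys f \<subseteq> S"
  shows "laurent_eval f P =
    (\<Sum>u\<in>S. Poly_Mapping.lookup f u * (fst P powi fst u * snd P powi snd u))"
  unfolding laurent_eval_def using assms
  by (intro sum.mono_neutral_left) (auto simp: in_keys_iff)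

text \<open>Since \<open>nat\<close> sends negative exponents to 0, this is meant for non-negative
  first exponents; the second ones may have any sign.\<close>

definition row_poly :: "'k::field laurent2 \<Rightarrow> 'k \<Rightarrow> 'k poly"
  where "row_poly f y =
    (\<Sum>u\<in>Poly_Mapping.keys f. monom (Poly_Mapping.lookup f u * y powi snd u) (nat (fst u)))"

text \<open>This is the polynomial c_i when f is written as the sum of X_1^i c_i(X_2), for
  non-negative second exponents.\<close>

definition column_coeff :: "'k::field laurent2 \<Rightarrow> int \<Rightarrow> 'k poly"
  where "column_coeff f i =
    (\<Sum>u | u \<in> Poly_Mapping.keys f \<and> fst u = i. monom (Poly_Mapping.lookup f u) (nat (snd u)))"

lemma poly_row_poly:
  assumes "\<And>u. u \<in> Poly_Mapping.keys f \<Longrightarrow> 0 \<le> fst u"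
  shows "poly (row_poly f y) x = laurent_eval f (x, y)"
  unfolding row_poly_def laurent_eval_def poly_sum poly_monom using assms
  by (intro sum.cong) (auto simp: power_int_def mult_ac)

lemma degree_row_poly_le:
  assumes "\<And>u. u \<in> Poly_Mapping.keys f \<Longrightarrow> fst u \<le> int n"
  shows "degree (row_poly f y) \<le> n"
  unfolding row_poly_def using assms
  by (intro degree_sum_le order.trans[OF degree_monom_le]) (auto simp: nat_le_iff)

lemma degree_column_coeff_le:
  assumes "\<And>u. u \<in> Poly_Mapping.keys f \<Longrightarrow> snd u \<le> int n"
  shows "degree (column_coeff f i) \<le> n"
  unfolding column_coeff_def using assms
  by (intro degree_sum_le order.trans[OF degree_monom_le]) (auto simp: nat_le_iff)

lemma coeff_row_poly:
  assumes "\<And>u. u \<in> Poly_Mapping.keys f \<Longrightarrow> 0 \<le> fst u \<and> 0 \<le> snd u" and "0 \<le> i"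
  shows "coeff (row_poly f y) (nat i) = poly (column_coeff f i) y"
proof -
  \<comment> \<open>Non-negativity makes \<open>nat\<close> injective on the exponents, so exactly
    the keys in column i contribute.\<close>
  have "coeff (row_poly f y) (nat i) = (\<Sum>u\<in>Poly_Mapping.keys f.
      if fst u = i then Poly_Mapping.lookup f u * y ^ nat (snd u) else 0)"
    unfolding row_poly_def coeff_sum using assms
    by (intro sum.cong) (auto simp: power_int_def nat_eq_iff)
  also have "\<dots> = poly (column_coeff f i) y"
    unfolding column_coeff_def poly_sum poly_monom
    by (simp add: sum.If_cases Int_def)
  finally show ?thesis .
qed

text \<open>Within one column the second exponents are distinct, so nothing cancels. A key of f thus
  certifies that its column coefficient is non-zero.\<close>

lemma coeff_column_coeff:
  assumes "\<And>u. u \<in> Poly_Mapping.keys f \<Longrightarrow> 0 \<le> snd u" and "(i, j) \<in> Poly_Mapping.keys f"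
  shows "coeff (column_coeff f i) (nat j) = Poly_Mapping.lookup f (i, j)"
proof -
  let ?K = "{u. u \<in> Poly_Mapping.keys f \<and> fst u = i}"
  have "0 \<le> j"
    using assms by force
  have "coeff (column_coeff f i) (nat j)
      = (\<Sum>u\<in>?K. if u = (i, j) then Poly_Mapping.lookup f u else 0)"
    unfolding column_coeff_def coeff_sum using assms \<open>0 \<le> j\<close>
    by (intro sum.cong) (auto simp: nat_eq_iff)
  also have "\<dots> = Poly_Mapping.lookup f (i, j)"
    using assms(2) by (subst sum.delta) auto
  finally show ?thesis .
qed

section \<open>Counting zeros on the torus\<close>

lemma card_poly_nonzeros_ge:
  fixes p :: "'k::{field,finite} poly"
  assumes "p \<noteq> 0" "degree p \<le> n"
  shows "CARD('k) - 1 - n \<le> card {x. x \<noteq> 0 \<and> poly p x \<noteq> 0}"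
proof -
  have "card (UNIV :: 'k set)
      \<le> card ({x. poly p x = 0} \<union> ({0} \<union> {x. x \<noteq> 0 \<and> poly p x \<noteq> 0}))"
    by (rule card_mono) auto
  also have "\<dots> \<le> card {x. poly p x = 0} + (1 + card {x. x \<noteq> 0 \<and> poly p x \<noteq> 0})"
    by (intro order.trans[OF card_Un_le] add_left_mono) (use card_Un_le in force)
  finally show ?thesis
    using card_poly_roots_bound[OF assms(1)] assms(2) by linarith
qed

lemma row_poly_nonzero:
  fixes f :: "'k::{field,finite} laurent2"
  assumes "f \<noteq> 0"
    and "\<And>u. u \<in> Poly_Mapping.keys f \<Longrightarrow> 0 \<le> fst u \<and> 0 \<le> snd u \<and> snd u \<le> int CARD('k) - 2"
  obtains y where "y \<noteq> 0" "row_poly f y \<noteq> 0"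
proof -
  obtain i j where ij: "(i, j) \<in> Poly_Mapping.keys f"
    using assms(1) by (metis keys_eq_empty ex_in_conv surj_pair)
  have "column_coeff f i \<noteq> 0"
    using coeff_column_coeff[of f i j] assms(2) ij by (auto simp: in_keys_iff)
  have card: "CARD('k) \<ge> 2"
    using assms(2)[OF ij] by linarith
  moreover have "degree (column_coeff f i) \<le> CARD('k) - 2"
    using assms(2) card by (intro degree_column_coeff_le) (auto simp: of_nat_diff)
  \<comment> \<open>Of the q - 1 non-zero elements at most q - 2 are roots.\<close>
  ultimately have "1 \<le> card {y. y \<noteq> 0 \<and> poly (column_coeff f i) y \<noteq> 0}"
    using card_poly_nonzeros_ge[OF \<open>column_coeff f i \<noteq> 0\<close>, of "CARD('k) - 2"] by linarith
  then have "{y. y \<noteq> 0 \<and> poly (column_coeff f i) y \<noteq> 0} \<noteq> {}"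
    by (metis card.empty not_one_le_zero)
  then obtain y where y: "y \<noteq> 0" "poly (column_coeff f i) y \<noteq> 0"
    by blast
  then have "coeff (row_poly f y) (nat i) \<noteq> 0"
    using coeff_row_poly[of f i y] assms(2) ij by force
  then show ?thesis
    using that[of y] y(1) by (metis coeff_0)
qed

lemma card_torus_zeros_le:
  fixes f :: "'k::{field,finite} laurent2"
  assumes "f \<noteq> 0"
    and "Poly_Mapping.keys f \<subseteq> {0..int n} \<times> {0..int CARD('k) - 2}"
  shows "card (torus_zeros f) \<le> (CARD('k) - 1)\<^sup>2 - (CARD('k) - 1 - n)"
proof -
  obtain y where y: "y \<noteq> 0" "row_poly f y \<noteq> 0"
    using row_poly_nonzero[OF assms(1)] assms(2) by force
  let ?N = "{x. x \<noteq> 0 \<and> poly (row_poly f y) x \<noteq> 0}"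
  have sub: "(\<lambda>x. (x, y)) ` ?N \<subseteq> torus"
    using y by (auto simp: torus_def)
  have "poly (row_poly f y) x = laurent_eval f (x, y)" for x
    by (rule poly_row_poly) (use assms(2) in auto)
  \<comment> \<open>One good line is enough: all other lines may consist of zeros.\<close>
  then have "torus_zeros f \<subseteq> torus - (\<lambda>x. (x, y)) ` ?N"
    by (auto simp: torus_zeros_def)
  then have "card (torus_zeros f) \<le> card (torus - (\<lambda>x. (x, y)) ` ?N)"
    by (intro card_mono) auto
  also have "\<dots> = (CARD('k) - 1)\<^sup>2 - card ((\<lambda>x. (x, y)) ` ?N)"
    using sub by (subst card_Diff_subset) (auto simp only: card_torus finite)
  also have "card ((\<lambda>x. (x, y)) ` ?N) = card ?N"
    by (intro card_image) (auto simp: inj_on_def)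
  also have "(CARD('k) - 1)\<^sup>2 - card ?N \<le> (CARD('k) - 1)\<^sup>2 - (CARD('k) - 1 - n)"
    using assms(2) y
    by (intro diff_le_mono2 card_poly_nonzeros_ge degree_row_poly_le) auto
  finally show ?thesis .
qed

section \<open>Separated products and privacy\<close>

lemma laurent_product:
  fixes p r :: "'k::field poly"
  obtains f where "Poly_Mapping.keys f \<subseteq> {0..int (degree p)} \<times> {0..int (degree r)}"
    and "\<And>x y. laurent_eval f (x, y) = poly p x * poly r y"
proof -
  \<comment> \<open>The coefficient function of p(X_1) r(X_2), extended by 0 to negative exponents.
    Its support is finite, as \<open>Abs_poly_mapping\<close> requires.\<close>
  define g where
    "g = (\<lambda>(i, j). if 0 \<le> i \<and> 0 \<le> j then coeff p (nat i) * coeff r (nat j) else 0)"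
  let ?h = "\<lambda>(i, j). (int i, int j)"
  let ?S = "?h ` ({..degree p} \<times> {..degree r})"
  have "u \<in> ?S" if "g u \<noteq> 0" for u
  proof -
    obtain i j where u: "u = (i, j)"
      by fastforce
    have "0 \<le> i" "0 \<le> j" "coeff p (nat i) \<noteq> 0" "coeff r (nat j) \<noteq> 0"
      using that by (auto simp: g_def u split: if_splits)
    then have "u = ?h (nat i, nat j)" "(nat i, nat j) \<in> {..degree p} \<times> {..degree r}"
      by (auto simp: u le_degree)
    then show ?thesis
      by blast
  qed
  then have supp: "{u. g u \<noteq> 0} \<subseteq> ?S"
    by blast
  then have fin: "finite {u. g u \<noteq> 0}"
    by (rule finite_subset) simp
  define f where "f = Abs_poly_mapping g"
  have lookup: "Poly_Mapping.lookup f = g"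
    unfolding f_def using fin by (rule lookup_Abs_poly_mapping)
  have keys: "Poly_Mapping.keys f \<subseteq> ?S"
    using supp by (auto simp: in_keys_iff lookup)
  show ?thesis
  proof
    show "Poly_Mapping.keys f \<subseteq> {0..int (degree p)} \<times> {0..int (degree r)}"
      using keys by auto
    fix x y
    have "laurent_eval f (x, y) = (\<Sum>u\<in>?S. g u * (x powi fst u * y powi snd u))"
      using laurent_eval_superset[OF _ keys, of "(x, y)"] by (simp add: lookup)
    also have "\<dots> = (\<Sum>(i, j)\<in>{..degree p} \<times> {..degree r}.
        (coeff p i * x ^ i) * (coeff r j * y ^ j))"
      by (subst sum.reindex) (auto simp: inj_on_def g_def mult_ac intro!: sum.cong)
    also have "\<dots> = poly p x * poly r y"
      by (simp add: poly_altdef sum_product sum.cartesian_product)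
    finally show "laurent_eval f (x, y) = poly p x * poly r y" .
  qed
qed

lemma poly_vanishing_exactly:
  fixes X :: "'k::field set"
  assumes "finite X"
  obtains p where "degree p = card X" "\<And>x. poly p x = 0 \<longleftrightarrow> x \<in> X"
proof
  let ?p = "\<Prod>c\<in>X. [:- c, 1:]"
  show "degree ?p = card X"
    by (subst degree_prod_eq_sum_degree) auto
  show "poly ?p x = 0 \<longleftrightarrow> x \<in> X" for x
    using assms by (auto simp: poly_prod)
qed

lemma has_privacy_rectangle:
  fixes P0 :: "'k::{field,finite} \<times> 'k"
  assumes "{0..b} \<times> {0..int CARD('k) - 2} \<subseteq> U" and "P0 \<in> torus"
  shows "has_privacy U P0 b"
  unfolding has_privacy_def
proof (intro allI impI)
  fix A :: "('k \<times> 'k) set"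
  assume A: "A \<subseteq> players P0" "int (card A) \<le> b"
  obtain x0 y0 where P0: "P0 = (x0, y0)" "x0 \<noteq> 0" "y0 \<noteq> 0"
    using assms(2) by (auto simp: torus_def)
  \<comment> \<open>As p must not vanish at \<open>x0\<close>, points of A with that abscissa are
    left to r; their ordinates differ from \<open>y0\<close> because P0 is not in A.\<close>
  obtain p where p: "degree p = card (fst ` A - {x0})" "\<And>x. poly p x = 0 \<longleftrightarrow> x \<in> fst ` A - {x0}"
    using poly_vanishing_exactly[of "fst ` A - {x0}"] by auto
  \<comment> \<open>Torus points never have ordinate 0, so r may skip that root. Its degree is then
    q - 2, exactly the height of the rectangle.\<close>
  obtain r where r: "degree r = card (UNIV - {0, y0})" "\<And>y. poly r y = 0 \<longleftrightarrow> y \<in> UNIV - {0, y0}"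
    using poly_vanishing_exactly[of "UNIV - {0, y0}"] by auto
  obtain f where f: "Poly_Mapping.keys f \<subseteq> {0..int (degree p)} \<times> {0..int (degree r)}"
    "\<And>x y. laurent_eval f (x, y) = poly p x * poly r y"
    using laurent_product by blast
  have "card (fst ` A - {x0}) \<le> card A"
    by (meson Diff_subset card_image_le card_mono finite order.trans)
  then have "int (degree p) \<le> b"
    using A(2) p(1) by linarith
  moreover have "card {0, y0} = 2"
    using P0 by simp
  then have "degree r = CARD('k) - 2" "CARD('k) \<ge> 2"
    using card_mono[of UNIV "{0, y0}"] by (auto simp only: r(1) card_Diff_subset finite subset_UNIV)
  ultimately have "{0..int (degree p)} \<times> {0..int (degree r)} \<subseteq> U"
    using assms(1) by (intro order.trans[OF Sigma_mono assms(1)]) auto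
  then have "f \<in> laurent_space U"
    using f(1) by (auto simp: laurent_space_eq_keys)
  moreover have "laurent_eval f P = 0" if "P \<in> A" for P
  proof (cases P)
    case (Pair x y)
    have "x = x0 \<longrightarrow> y \<noteq> y0" "y \<noteq> 0"
      using A(1) that by (auto simp: Pair P0(1) players_def torus_def)
    moreover have "x \<in> fst ` A"
      using that by (force simp: Pair)
    ultimately show ?thesis
      by (cases "x = x0") (auto simp: Pair f(2) p(2) r(2))
  qed
  moreover have "laurent_eval f P0 \<noteq> 0"
    by (simp add: P0(1) f(2) p(2) r(2))
  ultimately show "\<not> determines_secret U P0 A"
    unfolding determines_secret_def by blast
qed

lemma has_privacy_mono: "has_privacy U P0 t \<Longrightarrow> s \<le> t \<Longrightarrow> has_privacy U P0 s"
  unfolding has_privacy_def by force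

text \<open>\<open>GREATEST\<close> yields a maximum only once one exists. The candidates from t
  upwards form a finite non-empty set, whose maximum also dominates those below t.\<close>

lemma privacy_threshold_ge:
  assumes "has_privacy U P0 t" "t \<le> int (card (players P0))"
  shows "t \<le> privacy_threshold U P0"
proof -
  let ?Q = "\<lambda>t. t \<le> int (card (players P0)) \<and> has_privacy U P0 t"
  let ?S = "{s. ?Q s \<and> t \<le> s}"
  have fin: "finite ?S"
    by (rule finite_subset[of _ "{t..int (card (players P0))}"]) auto
  have t: "t \<in> ?S"
    using assms by simp
  have max: "Max ?S \<in> ?S"
    by (rule Max_in[OF fin]) (use t in blast)
  have "privacy_threshold U P0 = Max ?S"
    unfolding privacy_threshold_def
  proof (rule Greatest_equality)
    show "?Q (Max ?S)"
      using max by simp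
    show "s \<le> Max ?S" if "?Q s" for s
      using that max Max_ge[OF fin, of s] by (cases "t \<le> s") auto
  qed
  then show ?thesis
    using Max_ge[OF fin t] by simp
qed

section \<open>Strong multiplication\<close>

lemma products_determine_product:
  fixes P0 :: "'k::{field,finite} \<times> 'k"
  assumes A: "card A + 2 * n < CARD('k) - 2" and P0: "P0 \<in> torus"
    and keys: "\<And>h u. h \<in> {f, f', g, g'} \<Longrightarrow> u \<in> Poly_Mapping.keys h \<Longrightarrow> 0 \<le> fst u \<and> fst u \<le> int n"
    and eq: "\<And>P. P \<in> players P0 - A \<Longrightarrow>
      laurent_eval f P * laurent_eval f' P = laurent_eval g P * laurent_eval g' P"
  shows "laurent_eval f P0 * laurent_eval f' P0 = laurent_eval g P0 * laurent_eval g' P0"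
proof (rule ccontr)
  assume neq: "\<not> ?thesis"
  obtain x0 y0 where P0': "P0 = (x0, y0)" "y0 \<noteq> 0"
    using P0 by (auto simp: torus_def)
  \<comment> \<open>On the line through P0 the second exponents only contribute constants, so the
    degree in X_1 alone matters.\<close>
  define p where "p = row_poly f y0 * row_poly f' y0 - row_poly g y0 * row_poly g' y0"
  have row: "poly (row_poly h y0) x = laurent_eval h (x, y0)" "degree (row_poly h y0) \<le> n"
    if "h \<in> {f, f', g, g'}" for h x
    using keys[OF that] by (auto intro!: poly_row_poly degree_row_poly_le)
  have p: "poly p x = laurent_eval f (x, y0) * laurent_eval f' (x, y0)
      - laurent_eval g (x, y0) * laurent_eval g' (x, y0)" for x
    by (simp add: p_def row)
  have "degree (row_poly h y0 * row_poly h' y0) \<le> 2 * n"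
    if "h \<in> {f, f', g, g'}" "h' \<in> {f, f', g, g'}" for h h'
    using degree_mult_le[of "row_poly h y0" "row_poly h' y0"] row(2)[OF that(1)] row(2)[OF that(2)]
    by linarith
  then have "degree p \<le> 2 * n"
    unfolding p_def by (intro degree_diff_le) auto
  moreover have "p \<noteq> 0"
    using neq p[of x0] by (auto simp: P0')
  ultimately have "CARD('k) - 1 - 2 * n \<le> card {x. x \<noteq> 0 \<and> poly p x \<noteq> 0}"
    by (intro card_poly_nonzeros_ge)
  also have "\<dots> \<le> card (insert x0 (fst ` A))"
  proof (rule card_mono)
    show "{x. x \<noteq> 0 \<and> poly p x \<noteq> 0} \<subseteq> insert x0 (fst ` A)"
    proof
      fix x
      assume "x \<in> {x. x \<noteq> 0 \<and> poly p x \<noteq> 0}"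
      then have "(x, y0) \<notin> players P0 - A" "(x, y0) \<in> torus"
        using eq[of "(x, y0)"] P0' by (auto simp: p torus_def)
      then show "x \<in> insert x0 (fst ` A)"
        by (force simp: players_def P0')
    qed
  qed simp
  also have "\<dots> \<le> Suc (card A)"
    using card_insert_le_m1[of "Suc (card A)" "fst ` A" x0] card_image_le[of A fst] by simp
  \<comment> \<open>The assumption reads |A| + 1 < q - 1 - 2n, the extra 1 accounting for
    P0.\<close>
  finally show False
    using A by linarith
qed

section \<open>The trapezoid between two rectangles\<close>

lemma trapezoid_subset_rectangle:
  fixes a b c :: real
  assumes "0 \<le> b" "b \<le> a" "0 \<le> c"
  shows "convex hull {(0, 0), (a, 0), (b, c), (0, c)} \<subseteq> {0..a} \<times> {0..c}"
  using assms by (intro hull_minimal convex_Times) auto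

text \<open>Three corners are vertices of the trapezoid; the fourth, (b, 0), lies on its bottom
  edge.\<close>

lemma rectangle_subset_trapezoid:
  fixes a b c :: real
  assumes "0 \<le> b" "b \<le> a" "0 \<le> c"
  shows "{0..b} \<times> {0..c} \<subseteq> convex hull {(0, 0), (a, 0), (b, c), (0, c)}" (is "_ \<subseteq> ?H")
proof -
  have "(b, 0) \<in> closed_segment (0, 0) (a, 0)"
    \<comment> \<open>If a = 0, then b = 0 and \<open>b / a\<close> is 0, still a valid
      parameter.\<close>
    using assms by (auto simp: in_segment divide_le_eq_1 intro!: exI[of _ "b / a"])
  also have "\<dots> \<subseteq> ?H"
    unfolding segment_convex_hull by (intro hull_mono) auto
  finally have "{0, b} \<times> {0, c} \<subseteq> ?H"
    by (auto intro: hull_inc)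
  then have "convex hull ({0, b} \<times> {0, c}) \<subseteq> ?H"
    by (intro hull_minimal) auto
  moreover have "{0..b} \<times> {0..c} = convex hull ({0, b} \<times> {0, c})"
    unfolding convex_hull_Times using assms
    by (simp add: closed_segment_eq_real_ivl flip: segment_convex_hull)
  ultimately show ?thesis
    by simp
qed

theorem theorem4p4:
  fixes P0 :: "'k::{field,finite} \<times> 'k"
    and q a b :: int
    and U :: "(int \<times> int) set"
  assumes q: "q = int CARD('k)"
    and ab: "0 \<le> b" "b \<le> a" "a \<le> q - 2"
    and U: "U = lattice_points (convex hull
      {(0, 0), (real_of_int a, 0), (real_of_int b, real_of_int (q - 2)), (0, real_of_int (q - 2))})"
    and P0: "P0 \<in> torus"
  shows "int (Max {card (torus_zeros f) | f :: 'k laurent2. f \<in> laurent_space U \<and> f \<noteq> 0})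
           \<le> (q - 1)\<^sup>2 - (q - 1 - a)
    \<and> int (reconstruction_threshold U P0) \<le> 1 + (q - 1)\<^sup>2 - (q - 1 - a)
    \<and> privacy_threshold U P0 \<ge> b - 1
    \<and> (2 * a \<le> q - 2 \<longrightarrow>
         (\<forall>t \<ge> 0. t \<le> min (b - 1) ((q - 2 - 2 * a) - 1) \<longrightarrow>
           has_strong_multiplication U P0 t))"
proof -
  let ?m = "nat a"
  let ?N = "(CARD('k) - 1)\<^sup>2 - (CARD('k) - 1 - ?m)"
  have q2: "q \<ge> 2" and a: "int ?m = a" "?m \<le> CARD('k) - 1"
    using ab q by auto
  \<comment> \<open>The polytope enters below only through two inclusions: the outer rectangle
    bounds degrees, the inner one supplies polynomials.\<close>
  have U_upper: "U \<subseteq> {0..int ?m} \<times> {0..int CARD('k) - 2}"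
    using trapezoid_subset_rectangle[of "real_of_int b" "real_of_int a" "real_of_int (q - 2)"] ab q2
    unfolding U lattice_points_def by (fastforce simp: q)
  have U_lower: "{0..b} \<times> {0..int CARD('k) - 2} \<subseteq> U"
    using rectangle_subset_trapezoid[of "real_of_int b" "real_of_int a" "real_of_int (q - 2)"] ab q2
    unfolding U lattice_points_def by (fastforce simp: q)
  \<comment> \<open>This keeps the outer subtraction in \<open>?N\<close> from truncating.\<close>
  have "CARD('k) - 1 - ?m \<le> (CARD('k) - 1)\<^sup>2"
    by (metis diff_le_self le_square order.trans power2_eq_square)
  then have N: "int ?N = (q - 1)\<^sup>2 - (q - 1 - a)"
    using a q q2 by (auto simp: of_nat_diff)
  have zeros: "card (torus_zeros f) \<le> ?N" if "f \<in> laurent_space U" "f \<noteq> 0" for f :: "'k laurent2"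
    using that U_upper a by (intro card_torus_zeros_le) (auto simp: laurent_space_eq_keys)

  let ?Z = "{card (torus_zeros f) | f :: 'k laurent2. f \<in> laurent_space U \<and> f \<noteq> 0}"
  \<comment> \<open>\<open>Max\<close> needs a finite non-empty set: the bound gives finiteness, the
    constant monomial 1 an element.\<close>
  have "finite ?Z"
    by (rule finite_subset[of _ "{..?N}"]) (use zeros in auto)
  moreover have "(0, 0) \<in> U"
    using U_lower ab q q2 by auto
  then have "laurent_monomial (0, 0) \<in> laurent_space U" "laurent_monomial (0, 0) \<noteq> (0 :: 'k laurent2)"
    by (simp_all add: laurent_space_eq_keys laurent_monomial_def flip: keys_eq_empty)
  then have "?Z \<noteq> {}"
    by blast
  ultimately have "Max ?Z \<le> ?N"
    using zeros by (subst Max_le_iff) auto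
  then have part1: "int (Max ?Z) \<le> (q - 1)\<^sup>2 - (q - 1 - a)"
    unfolding N[symmetric] by simp

  \<comment> \<open>More than \<open>?N\<close> zeros force f = 0. For a = q - 2 the bound is n + 1
    and the claim is vacuous.\<close>
  have "determines_secret U P0 A" if A: "A \<subseteq> players P0" "1 + ?N \<le> card A" for A
    unfolding determines_secret_def
  proof (intro ballI impI)
    fix f :: "'k laurent2"
    assume f: "f \<in> laurent_space U" "\<forall>P\<in>A. laurent_eval f P = 0"
    then have "A \<subseteq> torus_zeros f"
      using A(1) by (auto simp: torus_zeros_def players_def)
    then have "card A \<le> card (torus_zeros f)"
      by (intro card_mono) auto
    then have "f = 0"
      using A(2) zeros[OF f(1)] by linarith
    then show "laurent_eval f P0 = 0"
      by (simp add: laurent_eval_def)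
  qed
  then have "reconstruction_threshold U P0 \<le> 1 + ?N"
    unfolding reconstruction_threshold_def by (intro Least_le) blast
  then have part2: "int (reconstruction_threshold U P0) \<le> 1 + (q - 1)\<^sup>2 - (q - 1 - a)"
    using N by linarith

  have privacy: "has_privacy U P0 t" if "t \<le> b - 1" for t
    using has_privacy_mono[OF has_privacy_rectangle[OF U_lower P0]] that by simp
  \<comment> \<open>The threshold is sought among t \<le> n, so b - 1 \<le> n must be checked; it
    follows from b \<le> q - 2 and q - 1 \<le> (q - 1)^2.\<close>
  have "card (players P0) = (CARD('k) - 1)\<^sup>2 - 1"
    unfolding players_def using P0 by (subst card_Diff_singleton) (auto simp only: card_torus)
  moreover have "1 \<le> (CARD('k) - 1)\<^sup>2" "CARD('k) - 1 \<le> (CARD('k) - 1)\<^sup>2"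
    using q q2 by (auto simp: power2_eq_square)
  ultimately have "b - 1 \<le> int (card (players P0))"
    using ab q by linarith
  then have part3: "privacy_threshold U P0 \<ge> b - 1"
    by (intro privacy_threshold_ge privacy) auto

  have "has_strong_multiplication U P0 t" if t: "0 \<le> t" "t \<le> min (b - 1) ((q - 2 - 2 * a) - 1)" for t
    unfolding has_strong_multiplication_def
  proof (intro conjI allI impI ballI)
    show "has_privacy U P0 t"
      using t by (intro privacy) simp
    fix A and f f' g g' :: "'k laurent2"
    assume A: "A \<subseteq> players P0" "int (card A) \<le> t"
      and f: "f \<in> laurent_space U" "f' \<in> laurent_space U" "g \<in> laurent_space U" "g' \<in> laurent_space U"
      and eq: "\<forall>P\<in>players P0 - A.
        laurent_eval f P * laurent_eval f' P = laurent_eval g P * laurent_eval g' P"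
    show "laurent_eval f P0 * laurent_eval f' P0 = laurent_eval g P0 * laurent_eval g' P0"
    proof (rule products_determine_product[OF _ P0])
      \<comment> \<open>The bound on t gives |A| + 2a \<le> q - 3.\<close>
      show "card A + 2 * ?m < CARD('k) - 2"
        using A(2) t(2) a(1) unfolding q min.bounded_iff by linarith
      show "0 \<le> fst u \<and> fst u \<le> int ?m" if "h \<in> {f, f', g, g'}" "u \<in> Poly_Mapping.keys h" for h u
        using that f U_upper by (fastforce simp: laurent_space_eq_keys)
    qed (use eq in blast)
  qed
  then show ?thesis
    using part1 part2 part3 by blast
qed

end
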